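(* Let $M^2_{\mathrm{reg}}\subset\mathbb{R}^5$ be a smooth regular surface, let $p\in M^2_{\mathrm{reg}}$, let $u\in T_pM^2_{\mathrm{reg}}$ be a unit tangent vector, and let $\pi_u$ be the orthogonal projection of $\mathbb{R}^5$ along $u$, so that $\pi_u(p)$ is a corank 1 singular point of $M^2_{\mathrm{sing}}=\pi_u(M^2_{\mathrm{reg}})\subset\mathbb{R}^4$. Let $\kappa_u^{\mathrm{reg}}$ be the umbilic curvature of $M^2_{\mathrm{reg}}$ at $p$ and $\kappa_u^{\mathrm{sing}}$ the umbilic curvature of $M^2_{\mathrm{sing}}$ at $\pi_u(p)$. Let $\Delta_e^5$ be the curvature ellipse of $M^2_{\mathrm{reg}}$ at $p$ and $\Delta_p$ the curvature parabola of $M^2_{\mathrm{sing}}$ at $\pi_u(p)$. (i) If $p\in\mathcal{M}_3$, then $\kappa_u^{\mathrm{reg}}\kappa_u^{\mathrm{sing}}\neq 0$. (ii) If $p\in\mathcal{M}_2$, the following are equivalent: (1) $\kappa_u^{\mathrm{reg}}=\kappa_u^{\mathrm{sing}}=0$; (2) $\Delta_e^5$ and $\Delta_p$ are (both) non-degenerate; (3) both $p$ and $\pi_u(p)$ are not semiumbilic. Also, if $p\in\mathcal{M}_2$, the following are equivalent: (1') $\kappa_u^{\mathrm{reg}}\kappa_u^{\mathrm{sing}}\neq 0$; (2') $\Delta_e^5$ and $\Delta_p$ are (both) degenerate (not a point); (3') both $p$ and $\pi_u(p)$ are semiumbilic.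
   Context: Regular surface in $\mathbb{R}^5$. $II_p:T_pM^2_{\mathrm{reg}}\times T_pM^2_{\mathrm{reg}}\to N_pM^2_{\mathrm{reg}}$ is the second fundamental form (normal component of the second derivative of a local parametrisation); $N_pM^2_{\mathrm{reg}}$ is the 3-dimensional normal space, regarded as an affine space with origin $p$. For an orthonormal basis $\{e_1,e_2\}$ of $T_pM^2_{\mathrm{reg}}$, $\alpha_p$ is the $3\times 3$ matrix whose columns are the coordinates of $II_p(e_1,e_1),II_p(e_1,e_2),II_p(e_2,e_2)$ in an orthonormal frame of $N_pM^2_{\mathrm{reg}}$. $\mathcal{M}_i$ is the set of points with $\operatorname{rank}\alpha_p=i$. The curvature ellipse is $\Delta_e^5=\{II_p(w,w): w\in T_pM^2_{\mathrm{reg}},|w|=1\}$; it may degenerate to a segment or a point. $\mathrm{Aff}_p$ is the smallest affine subspace of $N_pM^2_{\mathrm{reg}}$ containing $\Delta_e^5$, and $\kappa_u^{\mathrm{reg}}(p)=d(p,\mathrm{Aff}_p)$ (the subscript $u$ in $\kappa_u$ stands for "umbilic", not for the vector $u$). The point $p$ is semiumbilic if $\Delta_e^5$ degenerates to a line segment that does not contain the origin $p$. Singular surface in $\mathbb{R}^4$. Let $g:\tilde M\to\mathbb{R}^4$ be a smooth map from a smooth surface, of corank 1 at $q\in\tilde M$, with image $M^2_{\mathrm{sing}}$; write $g(q)$ for the singular point. Its tangent line is $\operatorname{Im}dg_q$, its normal space $N$ is the 3-dimensional orthogonal complement of $\operatorname{Im}dg_q$. The first fundamental form on $T_q\tilde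 M$ is $I(v,w)=\langle dg_q(v),dg_q(w)\rangle$ and the second fundamental form $II:T_q\tilde M\times T_q\tilde M\to N$ is the symmetric bilinear map given in local coordinates by the orthogonal projection to $N$ of the second partial derivatives of $g$. Let $C_q=\{w\in T_q\tilde M: I(w,w)=1\}$. The curvature parabola is $\Delta=\{II(w,w): w\in C_q\}\subset N$; it is a plane curve which may degenerate to a half-line, a line or a point. Its umbilic curvature is $\kappa_u^{\mathrm{sing}}=d(g(q),\mathrm{Aff})$, with $\mathrm{Aff}$ the smallest affine subspace of $N$ containing the curvature parabola, $N$ having origin $g(q)$. The point $g(q)$ is semiumbilic if the curvature parabola is a half-line or a line which is not radial (radial means that the line containing it passes through the origin). Here $g$ is the restriction of $\pi_u$ to $M^2_{\mathrm{reg}}$, with $\tilde M=M^2_{\mathrm{reg}}$ and $q=p$; $\pi_u(x)=x-\langle x,u\rangle u$, with values in $u^\perp\cong\mathbb{R}^4$. *)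

theory Defs
  imports "HOL-Analysis.Analysis"
begin

section \<open>Smooth maps and regular surfaces\<close>

text \<open>\<open>C\<^sup>k\<close> and \<open>C\<^sup>\<infinity>\<close> maps; meant for open sets \<open>S\<close> only.\<close>

primrec Ck_on :: "nat \<Rightarrow> 'a::real_normed_vector set \<Rightarrow> ('a \<Rightarrow> 'b::real_normed_vector) \<Rightarrow> bool" where
  "Ck_on 0 S f \<longleftrightarrow> continuous_on S f"
| "Ck_on (Suc k) S f \<longleftrightarrow> (\<forall>x\<in>S. f differentiable (at x)) \<and>
     (\<forall>v. Ck_on k S (\<lambda>x. frechet_derivative f (at x) v))"

definition smooth_on :: "'a::real_normed_vector set \<Rightarrow> ('a \<Rightarrow> 'b::real_normed_vector) \<Rightarrow> bool" where
  "smooth_on S f \<longleftrightarrow> (\<forall>k. Ck_on k S f)"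

definition local_parametrization ::
    "'a::euclidean_space set \<Rightarrow> (real^2) set \<Rightarrow> (real^2 \<Rightarrow> 'a) \<Rightarrow> bool" where
  "local_parametrization M U \<phi> \<longleftrightarrow>
     open U \<and> smooth_on U \<phi> \<and>
     (\<forall>x\<in>U. inj (frechet_derivative \<phi> (at x))) \<and>
     openin (top_of_set M) (\<phi> ` U) \<and>
     (\<exists>\<psi>. homeomorphism U (\<phi> ` U) \<phi> \<psi>)"

definition regular_surface :: "'a::euclidean_space set \<Rightarrow> bool" where
  "regular_surface M \<longleftrightarrow> (\<forall>p\<in>M. \<exists>U \<phi>. local_parametrization M U \<phi> \<and> p \<in> \<phi> ` U)"

text \<open>From here on the objects at a point \<open>p\<close> of a surface are computed in a local
  parametrization \<open>\<phi>\<close> with \<open>\<phi> a = p\<close>; none of them depends on the choice of \<open>(\<phi>, a)\<close>.\<close>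

definition tangent_space :: "(real^2 \<Rightarrow> 'a::euclidean_space) \<Rightarrow> real^2 \<Rightarrow> 'a set" where
  "tangent_space \<phi> a = range (frechet_derivative \<phi> (at a))"

text \<open>The coordinates of a tangent vector with respect to the basis of partial derivatives
  of \<open>\<phi>\<close> (only meaningful for vectors in \<open>tangent_space \<phi> a\<close>).\<close>

definition tangent_coords :: "(real^2 \<Rightarrow> 'a::euclidean_space) \<Rightarrow> real^2 \<Rightarrow> 'a \<Rightarrow> real^2" where
  "tangent_coords \<phi> a w = inv (frechet_derivative \<phi> (at a)) w"

definition second_derivative ::
    "('a::real_normed_vector \<Rightarrow> 'b::real_normed_vector) \<Rightarrow> 'a \<Rightarrow> 'a \<Rightarrow> 'a \<Rightarrow> 'b" where
  "second_derivative f a v w =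
     frechet_derivative (\<lambda>x. frechet_derivative f (at x) w) (at a) v"

definition orth_proj :: "'a::euclidean_space set \<Rightarrow> 'a \<Rightarrow> 'a" where
  "orth_proj N x = (THE y. y \<in> N \<and> x - y \<in> orthogonal_comp N)"


section \<open>Notions common to the regular and the singular case\<close>

text \<open>A normal space is the linear subspace of normal vectors, so the base point, which is
  the origin of the normal space as an affine space, is \<open>0\<close>.\<close>

definition umbilic_curvature :: "'a::euclidean_space set \<Rightarrow> real" where
  "umbilic_curvature D = infdist 0 (affine hull D)"

definition is_point :: "'a set \<Rightarrow> bool" where
  "is_point S \<longleftrightarrow> (\<exists>x. S = {x})"

definition is_segment :: "'a::euclidean_space set \<Rightarrow> bool" where
  "is_segment S \<longleftrightarrow> (\<exists>x y. x \<noteq> y \<and> S = closed_segment x y)"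

definition is_line :: "'a::euclidean_space set \<Rightarrow> bool" where
  "is_line S \<longleftrightarrow> (\<exists>x d. d \<noteq> 0 \<and> S = {x + t *\<^sub>R d | t. True})"

definition is_half_line :: "'a::euclidean_space set \<Rightarrow> bool" where
  "is_half_line S \<longleftrightarrow> (\<exists>x d. d \<noteq> 0 \<and> S = {x + t *\<^sub>R d | t. t \<ge> 0})"

definition radial :: "'a::euclidean_space set \<Rightarrow> bool" where
  "radial S \<longleftrightarrow> (\<exists>l. is_line l \<and> S \<subseteq> l \<and> 0 \<in> l)"


section \<open>Regular surfaces\<close>

definition normal_space_reg :: "(real^2 \<Rightarrow> 'a::euclidean_space) \<Rightarrow> real^2 \<Rightarrow> 'a set" where
  "normal_space_reg \<phi> a = orthogonal_comp (tangent_space \<phi> a)"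

definition II_reg :: "(real^2 \<Rightarrow> 'a::euclidean_space) \<Rightarrow> real^2 \<Rightarrow> 'a \<Rightarrow> 'a \<Rightarrow> 'a" where
  "II_reg \<phi> a v w = orth_proj (normal_space_reg \<phi> a)
     (second_derivative \<phi> a (tangent_coords \<phi> a v) (tangent_coords \<phi> a w))"

definition orthonormal_basis :: "'a::euclidean_space set \<Rightarrow> 'a list \<Rightarrow> bool" where
  "orthonormal_basis V bs \<longleftrightarrow> distinct bs \<and> pairwise orthogonal (set bs) \<and>
     (\<forall>b\<in>set bs. norm b = 1) \<and> span (set bs) = V"

definition alpha_matrix ::
    "(real^2 \<Rightarrow> real^5) \<Rightarrow> real^2 \<Rightarrow> real^5 \<Rightarrow> real^5 \<Rightarrow> real^5 \<Rightarrow> real^5 \<Rightarrow> real^5 \<Rightarrow> real^3^3" where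
  "alpha_matrix \<phi> a e1 e2 n1 n2 n3 =
     (let coords = (\<lambda>x. vector [x \<bullet> n1, x \<bullet> n2, x \<bullet> n3] :: real^3)
      in transpose (vector [coords (II_reg \<phi> a e1 e1),
                            coords (II_reg \<phi> a e1 e2),
                            coords (II_reg \<phi> a e2 e2)]))"

text \<open>\<open>\<phi> a \<in> \<M>\<^sub>i\<close>. The rank is the same for all orthonormal bases of the tangent space
  and all orthonormal frames of the normal space.\<close>

definition in_stratum :: "(real^2 \<Rightarrow> real^5) \<Rightarrow> real^2 \<Rightarrow> nat \<Rightarrow> bool" where
  "in_stratum \<phi> a i \<longleftrightarrow>
     (\<exists>e1 e2 n1 n2 n3. orthonormal_basis (tangent_space \<phi> a) [e1, e2] \<and>
        orthonormal_basis (normal_space_reg \<phi> a) [n1, n2, n3] \<and>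
        rank (alpha_matrix \<phi> a e1 e2 n1 n2 n3) = i)"

definition curvature_ellipse :: "(real^2 \<Rightarrow> 'a::euclidean_space) \<Rightarrow> real^2 \<Rightarrow> 'a set" where
  "curvature_ellipse \<phi> a = {II_reg \<phi> a w w | w. w \<in> tangent_space \<phi> a \<and> norm w = 1}"

definition degenerate_ellipse :: "'a::euclidean_space set \<Rightarrow> bool" where
  "degenerate_ellipse E \<longleftrightarrow> is_segment E \<or> is_point E"

definition kappa_u_reg :: "(real^2 \<Rightarrow> 'a::euclidean_space) \<Rightarrow> real^2 \<Rightarrow> real" where
  "kappa_u_reg \<phi> a = umbilic_curvature (curvature_ellipse \<phi> a)"

definition semiumbilic_reg :: "(real^2 \<Rightarrow> 'a::euclidean_space) \<Rightarrow> real^2 \<Rightarrow> bool" where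
  "semiumbilic_reg \<phi> a \<longleftrightarrow>
     is_segment (curvature_ellipse \<phi> a) \<and> 0 \<notin> curvature_ellipse \<phi> a"


section \<open>Singular surfaces\<close>

text \<open>The singular surface is the image of \<open>g\<close>, a map on the surface parametrized by \<open>\<phi>\<close>;
  the singular point is \<open>g (\<phi> a)\<close>.\<close>

definition differential ::
    "('a::euclidean_space \<Rightarrow> 'b::euclidean_space) \<Rightarrow> (real^2 \<Rightarrow> 'a) \<Rightarrow> real^2 \<Rightarrow> 'a \<Rightarrow> 'b" where
  "differential g \<phi> a w = frechet_derivative (g \<circ> \<phi>) (at a) (tangent_coords \<phi> a w)"

definition I_sing ::
    "('a::euclidean_space \<Rightarrow> 'b::euclidean_space) \<Rightarrow> (real^2 \<Rightarrow> 'a) \<Rightarrow> real^2 \<Rightarrow> 'a \<Rightarrow> 'a \<Rightarrow> real" where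
  "I_sing g \<phi> a v w = differential g \<phi> a v \<bullet> differential g \<phi> a w"

definition normal_space_sing ::
    "('a::euclidean_space \<Rightarrow> 'b::euclidean_space) \<Rightarrow> (real^2 \<Rightarrow> 'a) \<Rightarrow> real^2 \<Rightarrow> 'b set" where
  "normal_space_sing g \<phi> a = orthogonal_comp (differential g \<phi> a ` tangent_space \<phi> a)"

definition II_sing ::
    "('a::euclidean_space \<Rightarrow> 'b::euclidean_space) \<Rightarrow> (real^2 \<Rightarrow> 'a) \<Rightarrow> real^2 \<Rightarrow> 'a \<Rightarrow> 'a \<Rightarrow> 'b" where
  "II_sing g \<phi> a v w = orth_proj (normal_space_sing g \<phi> a)
     (second_derivative (g \<circ> \<phi>) a (tangent_coords \<phi> a v) (tangent_coords \<phi> a w))"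

definition unit_tangents_sing ::
    "('a::euclidean_space \<Rightarrow> 'b::euclidean_space) \<Rightarrow> (real^2 \<Rightarrow> 'a) \<Rightarrow> real^2 \<Rightarrow> 'a set" where
  "unit_tangents_sing g \<phi> a = {w \<in> tangent_space \<phi> a. I_sing g \<phi> a w w = 1}"

definition curvature_parabola ::
    "('a::euclidean_space \<Rightarrow> 'b::euclidean_space) \<Rightarrow> (real^2 \<Rightarrow> 'a) \<Rightarrow> real^2 \<Rightarrow> 'b set" where
  "curvature_parabola g \<phi> a = {II_sing g \<phi> a w w | w. w \<in> unit_tangents_sing g \<phi> a}"

definition degenerate_parabola :: "'a::euclidean_space set \<Rightarrow> bool" where
  "degenerate_parabola P \<longleftrightarrow> is_half_line P \<or> is_line P \<or> is_point P"

definition kappa_u_sing ::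
    "('a::euclidean_space \<Rightarrow> 'b::euclidean_space) \<Rightarrow> (real^2 \<Rightarrow> 'a) \<Rightarrow> real^2 \<Rightarrow> real" where
  "kappa_u_sing g \<phi> a = umbilic_curvature (curvature_parabola g \<phi> a)"

definition semiumbilic_sing ::
    "('a::euclidean_space \<Rightarrow> 'b::euclidean_space) \<Rightarrow> (real^2 \<Rightarrow> 'a) \<Rightarrow> real^2 \<Rightarrow> bool" where
  "semiumbilic_sing g \<phi> a \<longleftrightarrow>
     (is_half_line (curvature_parabola g \<phi> a) \<or> is_line (curvature_parabola g \<phi> a)) \<and>
     \<not> radial (curvature_parabola g \<phi> a)"


section \<open>Projection along a tangent vector\<close>

definition proj_along :: "'a::euclidean_space \<Rightarrow> 'a \<Rightarrow> 'a" where
  "proj_along u x = x - (x \<bullet> u) *\<^sub>R u"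

text \<open>\<open>J\<close> is an identification of \<open>u\<^sup>\<bottom>\<close> with \<open>\<real>\<^sup>4\<close>: its restriction to \<open>u\<^sup>\<bottom>\<close> is a linear isometry
  (automatically onto, by dimension). Its values off \<open>u\<^sup>\<bottom>\<close> play no role.\<close>

definition identifies_complement :: "real^5 \<Rightarrow> (real^5 \<Rightarrow> real^4) \<Rightarrow> bool" where
  "identifies_complement u J \<longleftrightarrow> linear J \<and> (\<forall>x\<in>orthogonal_comp {u}. norm (J x) = norm x)"

end

theory Submission
  imports Defs
begin

text \<open>
  Write \<open>u, v\<close> for an orthonormal basis of the tangent plane and \<open>A = II(u, u)\<close>, \<open>B = II(u, v)\<close>,
  \<open>C = II(v, v)\<close>. The curvature ellipse is the set of all \<open>x\<^sup>2 A + 2 x y B + y\<^sup>2 C\<close> with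
  \<open>x\<^sup>2 + y\<^sup>2 = 1\<close>. The projection along \<open>u\<close> maps the normal space of the regular surface
  isometrically into that of the singular one, carries the one second fundamental form to the
  other (\<open>II_sing_eq_J_II_reg\<close>) and turns the first fundamental form into \<open>y\<^sup>2\<close>; up to this isometry
  the curvature parabola is therefore the set of all \<open>x\<^sup>2 A + 2 x B + C\<close>. Both curves have the
  linear span of \<open>A, B, C\<close>, whose dimension is the rank of the matrix \<open>\<alpha>\<close>, and both lie in planes.

  For every nonempty set, the dimension of the linear span is the affine dimension, plus one if
  the umbilic curvature is nonzero (\<open>dim_eq_aff_dim_umbilic_curvature\<close>). In rank 3 a plane curve
  thus has nonzero umbilic curvature. In rank 2 the umbilic curvature vanishes iff the curve has
  affine dimension 2, and otherwise the curve has affine dimension 1: it is then a segment,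
  respectively a half-line or a line, and the line that carries it misses the origin. Hence for
  each of the two curves separately, being degenerate, having nonzero umbilic curvature and being
  semiumbilic are equivalent, and the curve is never a point
  (\<open>conic_ellipse_dim_2\<close>, \<open>conic_parabola_dim_2\<close>).

  That the ellipse is given by a quadratic form with the three coefficients \<open>A, B, C\<close> relies on the
  symmetry of second derivatives, which is derived from the mean value theorem.
\<close>

section \<open>Symmetry of second derivatives\<close>

text \<open>The second difference of \<open>f\<close> over a parallelogram is, after the mean value theorem in direction
  \<open>v\<close> and then in direction \<open>w\<close>, a value of the mixed second derivative inside it.\<close>

lemma second_difference_mean_value:
  fixes f :: "'a::real_normed_vector \<Rightarrow> real"
  assumes "0 < h"
    and f: "\<And>s t. \<lbrakk>s \<in> {0..h}; t \<in> {0..h}\<rbrakk> \<Longrightarrow>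
        (f has_derivative f' (a + s *\<^sub>R v + t *\<^sub>R w)) (at (a + s *\<^sub>R v + t *\<^sub>R w))"
    and f': "\<And>s t. \<lbrakk>s \<in> {0..h}; t \<in> {0..h}\<rbrakk> \<Longrightarrow>
        ((\<lambda>x. f' x v) has_derivative f'' (a + s *\<^sub>R v + t *\<^sub>R w)) (at (a + s *\<^sub>R v + t *\<^sub>R w))"
  obtains s t where "s \<in> {0..h}" and "t \<in> {0..h}"
    and "f (a + h *\<^sub>R v + h *\<^sub>R w) - f (a + h *\<^sub>R v) - f (a + h *\<^sub>R w) + f a
           = h\<^sup>2 * f'' (a + s *\<^sub>R v + t *\<^sub>R w) w"
proof -
  define \<phi> where "\<phi> s = f (a + s *\<^sub>R v + h *\<^sub>R w) - f (a + s *\<^sub>R v + 0 *\<^sub>R w)" for s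
  have \<phi>: "(\<phi> has_derivative
      (\<lambda>r. r * (f' (a + s *\<^sub>R v + h *\<^sub>R w) v - f' (a + s *\<^sub>R v + 0 *\<^sub>R w) v))) (at s within {0..h})"
    if s: "s \<in> {0..h}" for s
  proof -
    have *: "((\<lambda>s. f (a + s *\<^sub>R v + t *\<^sub>R w)) has_derivative (\<lambda>r. r * f' (a + s *\<^sub>R v + t *\<^sub>R w) v))
        (at s within {0..h})" if t: "t \<in> {0..h}" for t
    proof -
      have "((\<lambda>s. a + s *\<^sub>R v + t *\<^sub>R w) has_derivative (\<lambda>r. r *\<^sub>R v)) (at s within {0..h})"
        by (auto intro!: derivative_eq_intros)
      from has_derivative_compose[OF this f[OF s t]]
      show ?thesis
        using linear_scale[OF has_derivative_linear[OF f[OF s t]]] by simp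
    qed
    show ?thesis unfolding \<phi>_def
      using has_derivative_diff[OF *[of h] *[of 0]] \<open>0 < h\<close> by (simp add: algebra_simps)
  qed
  obtain s where s: "s \<in> {0<..<h}"
    and s_eq: "\<phi> h - \<phi> 0 = h * (f' (a + s *\<^sub>R v + h *\<^sub>R w) v - f' (a + s *\<^sub>R v + 0 *\<^sub>R w) v)"
    using mvt_simple[OF \<open>0 < h\<close>, of \<phi>
        "\<lambda>s r. r * (f' (a + s *\<^sub>R v + h *\<^sub>R w) v - f' (a + s *\<^sub>R v + 0 *\<^sub>R w) v)"] \<phi>
    by auto
  have \<psi>: "((\<lambda>t. f' (a + s *\<^sub>R v + t *\<^sub>R w) v) has_derivative (\<lambda>r. r * f'' (a + s *\<^sub>R v + t *\<^sub>R w) w))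
      (at t within {0..h})" if t: "t \<in> {0..h}" for t
  proof -
    have s': "s \<in> {0..h}" using s by simp
    have "((\<lambda>t. a + s *\<^sub>R v + t *\<^sub>R w) has_derivative (\<lambda>r. r *\<^sub>R w)) (at t within {0..h})"
      by (auto intro!: derivative_eq_intros)
    from has_derivative_compose[OF this f'[OF s' t]]
    show ?thesis
      using linear_scale[OF has_derivative_linear[OF f'[OF s' t]]] by simp
  qed
  obtain t where t: "t \<in> {0<..<h}"
    and t_eq: "f' (a + s *\<^sub>R v + h *\<^sub>R w) v - f' (a + s *\<^sub>R v + 0 *\<^sub>R w) v
      = h * f'' (a + s *\<^sub>R v + t *\<^sub>R w) w"
    using mvt_simple[OF \<open>0 < h\<close>, of "\<lambda>t. f' (a + s *\<^sub>R v + t *\<^sub>R w) v"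
        "\<lambda>t r. r * f'' (a + s *\<^sub>R v + t *\<^sub>R w) w"] \<psi>
    by auto
  have "f (a + h *\<^sub>R v + h *\<^sub>R w) - f (a + h *\<^sub>R v) - f (a + h *\<^sub>R w) + f a = \<phi> h - \<phi> 0"
    by (simp add: \<phi>_def)
  also have "\<dots> = h\<^sup>2 * f'' (a + s *\<^sub>R v + t *\<^sub>R w) w"
    unfolding s_eq t_eq by (simp add: power2_eq_square)
  finally show thesis using s t by (intro that[of s t]) auto
qed

text \<open>Symmetry of mixed second derivatives (Schwarz): the second difference is symmetric in \<open>v\<close> and
  \<open>w\<close>, so on every small parallelogram at \<open>a\<close> some value of the one mixed derivative equals
  some value of the other; by continuity their values at \<open>a\<close> agree.\<close>

lemma mixed_derivatives_commute_real:
  fixes f :: "'a::real_normed_vector \<Rightarrow> real"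
  assumes "open U" "a \<in> U"
    and f: "\<And>x. x \<in> U \<Longrightarrow> (f has_derivative f' x) (at x)"
    and f'v: "\<And>x. x \<in> U \<Longrightarrow> ((\<lambda>x. f' x v) has_derivative fv x) (at x)"
    and f'w: "\<And>x. x \<in> U \<Longrightarrow> ((\<lambda>x. f' x w) has_derivative fw x) (at x)"
    and cv: "continuous_on U (\<lambda>x. fv x w)"
    and cw: "continuous_on U (\<lambda>x. fw x v)"
  shows "fv a w = fw a v"
proof (rule ccontr)
  assume ne: "fv a w \<noteq> fw a v"
  define e where "e = dist (fv a w) (fw a v) / 2"
  have "e > 0" using ne by (simp add: e_def)
  have "isCont (\<lambda>x. fv x w) a" "isCont (\<lambda>x. fw x v) a"
    using cv cw assms(1,2) by (auto simp: continuous_on_eq_continuous_at)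
  then have ev: "\<forall>\<^sub>F x in nhds a. dist (fv x w) (fv a w) < e" "\<forall>\<^sub>F x in nhds a. dist (fw x v) (fw a v) < e"
    using \<open>e > 0\<close> by (auto simp: continuous_at_eps_delta eventually_nhds_metric)
  have "\<forall>\<^sub>F x in nhds a. x \<in> U \<and> dist (fv x w) (fv a w) < e \<and> dist (fw x v) (fw a v) < e"
    using ev assms(1,2) by (auto simp: eventually_conj_iff eventually_nhds_in_open)
  then obtain d where "d > 0" and
    d: "\<And>x. dist x a < d \<Longrightarrow> x \<in> U \<and> dist (fv x w) (fv a w) < e \<and> dist (fw x v) (fw a v) < e"
    unfolding eventually_nhds_metric by blast
  \<comment> \<open>small enough for the whole parallelogram to lie in the ball of radius \<open>d\<close>; the \<open>+ 1\<close>
    covers \<open>v = w = 0\<close>\<close>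
  define h where "h = d / (norm v + norm w + 1)"
  have "norm v + norm w + 1 > 0" by (simp add: add_nonneg_pos)
  then have "h > 0" using \<open>d > 0\<close> by (simp add: h_def)
  have h: "h * (norm v + norm w) < d"
  proof -
    have "d = h * (norm v + norm w + 1)"
      using \<open>norm v + norm w + 1 > 0\<close> by (simp add: h_def)
    with \<open>h > 0\<close> show ?thesis by (simp add: algebra_simps)
  qed
  have near: "dist (a + s *\<^sub>R v + t *\<^sub>R w) a < d" if "s \<in> {0..h}" "t \<in> {0..h}" for s t
  proof -
    have "dist (a + s *\<^sub>R v + t *\<^sub>R w) a = norm (s *\<^sub>R v + t *\<^sub>R w)"
      by (simp add: dist_norm algebra_simps)
    also have "\<dots> \<le> s * norm v + t * norm w"
      using norm_triangle_ineq[of "s *\<^sub>R v" "t *\<^sub>R w"] that by simp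
    also have "\<dots> \<le> h * norm v + h * norm w"
      using that by (intro add_mono mult_right_mono) auto
    finally show ?thesis using h by (simp add: algebra_simps)
  qed
  have near': "dist (a + t *\<^sub>R w + s *\<^sub>R v) a < d" if "s \<in> {0..h}" "t \<in> {0..h}" for s t
    using near[OF that] by (simp add: algebra_simps)
  let ?\<Delta> = "f (a + h *\<^sub>R v + h *\<^sub>R w) - f (a + h *\<^sub>R v) - f (a + h *\<^sub>R w) + f a"
  obtain s t where st: "s \<in> {0..h}" "t \<in> {0..h}" "?\<Delta> = h\<^sup>2 * fv (a + s *\<^sub>R v + t *\<^sub>R w) w"
    by (rule second_difference_mean_value[OF \<open>h > 0\<close>, of f f' a v w fv])
       (use near d f f'v in blast)+
  obtain t' s' where st': "t' \<in> {0..h}" "s' \<in> {0..h}"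
    "f (a + h *\<^sub>R w + h *\<^sub>R v) - f (a + h *\<^sub>R w) - f (a + h *\<^sub>R v) + f a
       = h\<^sup>2 * fw (a + t' *\<^sub>R w + s' *\<^sub>R v) v"
    by (rule second_difference_mean_value[OF \<open>h > 0\<close>, of f f' a w v fw])
       (use near' d f f'w in blast)+
  have "f (a + h *\<^sub>R w + h *\<^sub>R v) - f (a + h *\<^sub>R w) - f (a + h *\<^sub>R v) + f a = ?\<Delta>"
    by (simp add: algebra_simps)
  then have "h\<^sup>2 * fv (a + s *\<^sub>R v + t *\<^sub>R w) w = h\<^sup>2 * fw (a + t' *\<^sub>R w + s' *\<^sub>R v) v"
    by (simp only: st(3) st'(3))
  then have "fv (a + s *\<^sub>R v + t *\<^sub>R w) w = fw (a + t' *\<^sub>R w + s' *\<^sub>R v) v"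
    using \<open>h > 0\<close> by simp
  moreover have "dist (fv (a + s *\<^sub>R v + t *\<^sub>R w) w) (fv a w) < e"
    using d near st by blast
  moreover have "dist (fw (a + t' *\<^sub>R w + s' *\<^sub>R v) v) (fw a v) < e"
    using d near' st' by blast
  ultimately have "dist (fv a w) (fw a v) < e + e"
    by (metis add_strict_mono dist_commute dist_triangle_lt dist_triangle2 order_le_less_trans)
  then show False by (simp add: e_def)
qed

lemma C2_on:
  assumes "smooth_on U f" and "x \<in> U"
  shows "f differentiable (at x)"
    and "(\<lambda>x. frechet_derivative f (at x) w) differentiable (at x)"
    and "continuous_on U (\<lambda>x. second_derivative f x v w)"
proof -
  have "Ck_on (Suc (Suc 0)) U f"
    using assms(1) unfolding smooth_on_def by blast
  then show "f differentiable (at x)"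
    and "(\<lambda>x. frechet_derivative f (at x) w) differentiable (at x)"
    and "continuous_on U (\<lambda>x. second_derivative f x v w)"
    using assms(2) by (simp_all add: second_derivative_def)
qed

lemma second_derivative_commute:
  fixes f :: "'a::real_normed_vector \<Rightarrow> 'b::euclidean_space"
  assumes "open U" "smooth_on U f" "a \<in> U"
  shows "second_derivative f a v w = second_derivative f a w v"
proof (rule euclidean_eqI)
  fix b :: 'b
  have 1: "((\<lambda>x. f x \<bullet> b) has_derivative (\<lambda>z. frechet_derivative f (at x) z \<bullet> b)) (at x)"
    if "x \<in> U" for x
    using C2_on(1)[OF assms(2) that] by (intro has_derivative_inner_left) (simp add: frechet_derivative_works)
  have 2: "((\<lambda>x. frechet_derivative f (at x) z \<bullet> b) has_derivative
              (\<lambda>y. second_derivative f x y z \<bullet> b)) (at x)" if "x \<in> U" for x z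
    unfolding second_derivative_def
    using C2_on(2)[OF assms(2) that] by (intro has_derivative_inner_left) (simp add: frechet_derivative_works)
  have 3: "continuous_on U (\<lambda>x. second_derivative f x y z \<bullet> b)" for y z
    using C2_on(3)[OF assms(2,3)] by (intro continuous_intros)
  show "second_derivative f a v w \<bullet> b = second_derivative f a w v \<bullet> b"
    by (rule mixed_derivatives_commute_real[OF assms(1,3) 1 2 2 3 3])
qed

lemma linear_second_derivative:
  assumes "smooth_on U f" "a \<in> U"
  shows "linear (\<lambda>v. second_derivative f a v w)"
  unfolding second_derivative_def using C2_on(2)[OF assms] by (rule linear_frechet_derivative)

lemma second_derivative_quadratic:
  fixes f :: "'a::real_normed_vector \<Rightarrow> 'b::euclidean_space"
  assumes "open U" "smooth_on U f" "a \<in> U"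
  shows "second_derivative f a (x *\<^sub>R v + y *\<^sub>R w) (x *\<^sub>R v + y *\<^sub>R w) =
    x\<^sup>2 *\<^sub>R second_derivative f a v v + (2 * x * y) *\<^sub>R second_derivative f a v w
      + y\<^sup>2 *\<^sub>R second_derivative f a w w"
proof -
  have lin: "second_derivative f a (x *\<^sub>R v + y *\<^sub>R w) z
      = x *\<^sub>R second_derivative f a v z + y *\<^sub>R second_derivative f a w z" for z
    using linear_second_derivative[OF assms(2,3), of z] by (simp add: linear_add[of "\<lambda>v. second_derivative f a v z"] linear_scale[of "\<lambda>v. second_derivative f a v z"])
  have lin': "second_derivative f a z (x *\<^sub>R v + y *\<^sub>R w)
      = x *\<^sub>R second_derivative f a z v + y *\<^sub>R second_derivative f a z w" for z
    using lin[of z] second_derivative_commute[OF assms] by metis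
  show ?thesis
    unfolding lin lin' second_derivative_commute[OF assms, of w v]
    by (simp add: algebra_simps power2_eq_square scaleR_2 flip: scaleR_add_left)
qed

lemma frechet_derivative_bounded_linear_compose:
  assumes "bounded_linear g" "f differentiable (at x)"
  shows "frechet_derivative (g \<circ> f) (at x) = g \<circ> frechet_derivative f (at x)"
proof -
  have "(f has_derivative frechet_derivative f (at x)) (at x)"
    using assms(2) by (simp add: frechet_derivative_works)
  then have "(g \<circ> f has_derivative g \<circ> frechet_derivative f (at x)) (at x)"
    using bounded_linear.has_derivative[OF assms(1)] by (simp add: o_def)
  then show ?thesis by (rule frechet_derivative_at[symmetric])
qed

lemma second_derivative_bounded_linear_compose:
  assumes "bounded_linear g" "open U" "smooth_on U f" "a \<in> U"
  shows "second_derivative (g \<circ> f) a v w = g (second_derivative f a v w)"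
proof -
  let ?D = "\<lambda>x. frechet_derivative f (at x) w"
  have "(?D has_derivative frechet_derivative ?D (at a)) (at a)"
    using C2_on(2)[OF assms(3,4)] by (simp add: frechet_derivative_works)
  then have "((\<lambda>x. g (?D x)) has_derivative (\<lambda>y. g (frechet_derivative ?D (at a) y))) (at a)"
    by (rule bounded_linear.has_derivative[OF assms(1)])
  moreover have "g (?D x) = frechet_derivative (g \<circ> f) (at x) w" if "x \<in> U" for x
    using frechet_derivative_bounded_linear_compose[OF assms(1) C2_on(1)[OF assms(3) that]] by simp
  ultimately have "((\<lambda>x. frechet_derivative (g \<circ> f) (at x) w) has_derivative
      (\<lambda>y. g (frechet_derivative ?D (at a) y))) (at a)"
    by (rule has_derivative_transform_within_open[OF _ assms(2,4)])
  from frechet_derivative_at[OF this, symmetric] show ?thesis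
    by (simp add: second_derivative_def)
qed

section \<open>Conics spanned by three vectors and their umbilic curvature\<close>

lemma umbilic_curvature_eq_0_iff:
  fixes S :: "'a::euclidean_space set"
  assumes "S \<noteq> {}"
  shows "umbilic_curvature S = 0 \<longleftrightarrow> 0 \<in> affine hull S"
  using assms by (simp add: umbilic_curvature_def in_closed_iff_infdist_zero)

text \<open>The identity that drives everything: adjoining the origin to \<open>S\<close> does not change its linear
  span, and raises its affine dimension exactly when the origin lies off \<open>affine hull S\<close>, that is,
  when the umbilic curvature is nonzero.\<close>

lemma dim_eq_aff_dim_umbilic_curvature:
  fixes S :: "'a::euclidean_space set"
  assumes "S \<noteq> {}"
  shows "int (dim S) = aff_dim S + (if umbilic_curvature S = 0 then 0 else 1)"
proof -
  have "aff_dim (insert 0 S) = int (dim (insert 0 S))"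
    by (intro aff_dim_zero hull_inc) simp
  then have "int (dim S) = aff_dim (insert 0 S)"
    by (metis dim_span span_insert_0)
  with assms show ?thesis
    by (simp add: aff_dim_insert umbilic_curvature_eq_0_iff)
qed

text \<open>The values of a quadratic form, with coefficient vectors \<open>A\<close>, \<open>B\<close>, \<open>C\<close>, on the unit circle and
  on the line \<open>y = 1\<close>. They are the shapes of the curvature ellipse and the curvature parabola:
  for a unit tangent vector \<open>u\<close> as first basis vector, the degenerate first fundamental form is \<open>y\<^sup>2\<close>.\<close>

definition conic_ellipse :: "'a::real_vector \<Rightarrow> 'a \<Rightarrow> 'a \<Rightarrow> 'a set" where
  "conic_ellipse A B C =
     {x\<^sup>2 *\<^sub>R A + (2 * x * y) *\<^sub>R B + y\<^sup>2 *\<^sub>R C | x y. x\<^sup>2 + y\<^sup>2 = 1}"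

definition conic_parabola :: "'a::real_vector \<Rightarrow> 'a \<Rightarrow> 'a \<Rightarrow> 'a set" where
  "conic_parabola A B C = {x\<^sup>2 *\<^sub>R A + (2 * x) *\<^sub>R B + C | x. True}"

lemma conic_ellipse_nonempty: "conic_ellipse A B C \<noteq> {}"
proof -
  have "1\<^sup>2 *\<^sub>R A + (2 * 1 * 0) *\<^sub>R B + 0\<^sup>2 *\<^sub>R C \<in> conic_ellipse A B C"
    unfolding conic_ellipse_def
    by (rule CollectI, rule exI[of _ 1], rule exI[of _ 0]) simp
  then show ?thesis by blast
qed

lemma span_conic_ellipse: "span (conic_ellipse A B C) = span {A, B, C}"
  unfolding span_eq
proof
  show "conic_ellipse A B C \<subseteq> span {A, B, C}"
    unfolding conic_ellipse_def
    by (auto intro!: span_add span_scale intro: span_base)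
next
  let ?E = "conic_ellipse A B C"
  have mem: "x\<^sup>2 *\<^sub>R A + (2 * x * y) *\<^sub>R B + y\<^sup>2 *\<^sub>R C \<in> span ?E" if "x\<^sup>2 + y\<^sup>2 = 1" for x y
    using that by (intro span_base) (auto simp: conic_ellipse_def)
  have A: "A \<in> span ?E" using mem[of 1 0] by simp
  have C: "C \<in> span ?E" using mem[of 0 1] by simp
  \<comment> \<open>\<open>(3/5, 4/5)\<close> is just a point of the circle off the axes, so that \<open>B\<close> occurs.\<close>
  have "(9/25) *\<^sub>R A + (24/25) *\<^sub>R B + (16/25) *\<^sub>R C \<in> span ?E"
    using mem[of "3/5" "4/5"] by (simp add: power2_eq_square)
  then have "(25/24) *\<^sub>R (((9/25) *\<^sub>R A + (24/25) *\<^sub>R B + (16/25) *\<^sub>R C)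
               - (9/25) *\<^sub>R A - (16/25) *\<^sub>R C) \<in> span ?E"
    using A C by (intro span_diff span_scale)
  then have "B \<in> span ?E" by simp
  then show "{A, B, C} \<subseteq> span ?E" using A C by simp
qed

lemma span_conic_parabola: "span (conic_parabola A B C) = span {A, B, C}"
  unfolding span_eq
proof
  show "conic_parabola A B C \<subseteq> span {A, B, C}"
    unfolding conic_parabola_def
    by (auto intro!: span_add span_scale intro: span_base)
next
  let ?P = "conic_parabola A B C"
  have mem: "x\<^sup>2 *\<^sub>R A + (2 * x) *\<^sub>R B + C \<in> span ?P" for x
    by (intro span_base) (auto simp: conic_parabola_def)
  have C: "C \<in> span ?P" using mem[of 0] by simp
  have p: "A + 2 *\<^sub>R B + C \<in> span ?P" and m: "A - 2 *\<^sub>R B + C \<in> span ?P"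
    using mem[of 1] mem[of "-1"] by simp_all
  have "(1/4) *\<^sub>R ((A + 2 *\<^sub>R B + C) - (A - 2 *\<^sub>R B + C)) \<in> span ?P"
    using p m by (intro span_diff span_scale)
  moreover have "(1/4) *\<^sub>R ((A + 2 *\<^sub>R B + C) - (A - 2 *\<^sub>R B + C)) = B"
    by (simp add: algebra_simps flip: scaleR_add_left)
  ultimately have B: "B \<in> span ?P" by simp
  have "(A + 2 *\<^sub>R B + C) - 2 *\<^sub>R B - C \<in> span ?P"
    using p B C by (intro span_diff span_scale)
  then have "A \<in> span ?P" by simp
  with B C show "{A, B, C} \<subseteq> span ?P" by simp
qed

lemma aff_dim_le_2_if_in_plane:
  fixes S :: "'a::euclidean_space set"
  assumes "S \<subseteq> (+) c ` span {P, Q}"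
  shows "aff_dim S \<le> 2"
proof -
  have "aff_dim S \<le> aff_dim ((+) c ` span {P, Q})"
    using assms by (rule aff_dim_subset)
  also have "\<dots> = int (dim {P, Q})"
    by (simp add: aff_dim_translation_eq aff_dim_subspace)
  also have "\<dots> \<le> int (card {P, Q})"
    using dim_le_card'[of "{P, Q}"] by simp
  also have "\<dots> \<le> 2"
    by (simp add: card_insert_if)
  finally show ?thesis .
qed

lemma aff_dim_conic_ellipse_le: "aff_dim (conic_ellipse A B C) \<le> 2"
proof (rule aff_dim_le_2_if_in_plane)
  show "conic_ellipse A B C \<subseteq> (+) C ` span {A - C, B}"
  proof
    fix z assume "z \<in> conic_ellipse A B C"
    then obtain x y where z: "z = x\<^sup>2 *\<^sub>R A + (2 * x * y) *\<^sub>R B + y\<^sup>2 *\<^sub>R C" and "x\<^sup>2 + y\<^sup>2 = 1"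
      by (auto simp: conic_ellipse_def)
    then have y: "y\<^sup>2 = 1 - x\<^sup>2" by simp
    have "z = C + (x\<^sup>2 *\<^sub>R (A - C) + (2 * x * y) *\<^sub>R B)"
      unfolding z y by (simp add: algebra_simps)
    moreover have "x\<^sup>2 *\<^sub>R (A - C) + (2 * x * y) *\<^sub>R B \<in> span {A - C, B}"
      by (intro span_add span_scale span_base) auto
    ultimately show "z \<in> (+) C ` span {A - C, B}" by blast
  qed
qed

lemma aff_dim_conic_parabola_le: "aff_dim (conic_parabola A B C) \<le> 2"
proof (rule aff_dim_le_2_if_in_plane)
  show "conic_parabola A B C \<subseteq> (+) C ` span {A, B}"
  proof
    fix z assume "z \<in> conic_parabola A B C"
    then obtain x where "z = C + (x\<^sup>2 *\<^sub>R A + (2 * x) *\<^sub>R B)"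
      by (auto simp: conic_parabola_def algebra_simps)
    moreover have "x\<^sup>2 *\<^sub>R A + (2 * x) *\<^sub>R B \<in> span {A, B}"
      by (intro span_add span_scale span_base) auto
    ultimately show "z \<in> (+) C ` span {A, B}" by blast
  qed
qed

text \<open>A compact connected subset of a line is a segment.\<close>

lemma conic_ellipse_segment:
  fixes A B C :: "'a::euclidean_space"
  assumes "aff_dim (conic_ellipse A B C) = 1"
  shows "is_segment (conic_ellipse A B C)"
proof -
  let ?E = "conic_ellipse A B C"
  let ?f = "\<lambda>z. (Re z)\<^sup>2 *\<^sub>R A + (2 * Re z * Im z) *\<^sub>R B + (Im z)\<^sup>2 *\<^sub>R C"
  have sphere: "z \<in> sphere 0 1 \<longleftrightarrow> (Re z)\<^sup>2 + (Im z)\<^sup>2 = 1" for z :: complex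
    by (simp add: cmod_def)
  have "?E = ?f ` sphere 0 1"
  proof (intro equalityI subsetI)
    fix w assume "w \<in> ?E"
    then obtain x y where "w = x\<^sup>2 *\<^sub>R A + (2 * x * y) *\<^sub>R B + y\<^sup>2 *\<^sub>R C" "x\<^sup>2 + y\<^sup>2 = 1"
      by (auto simp: conic_ellipse_def)
    then show "w \<in> ?f ` sphere 0 1"
      by (intro image_eqI[of _ _ "Complex x y"]) (simp, simp only: sphere complex.sel)
  next
    fix w assume "w \<in> ?f ` sphere 0 1"
    then show "w \<in> ?E"
      unfolding conic_ellipse_def using sphere by blast
  qed
  moreover have "continuous_on (sphere 0 1) ?f"
    by (intro continuous_intros)
  ultimately have "compact ?E" "connected ?E"
    using compact_continuous_image[of "sphere 0 1" ?f] connected_continuous_image[of "sphere 0 1" ?f]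
    by (simp_all add: connected_sphere)
  moreover have "collinear ?E"
    using assms by (simp add: collinear_aff_dim)
  ultimately obtain x y where xy: "?E = closed_segment x y"
    using compact_convex_collinear_segment_alt[of ?E] conic_ellipse_nonempty by blast
  moreover have "x \<noteq> y"
  proof
    assume "x = y"
    with xy assms show False by simp
  qed
  ultimately show ?thesis unfolding is_segment_def by blast
qed

lemma aff_dim_1_line:
  fixes S :: "'a::euclidean_space set"
  assumes "aff_dim S = 1" and "c \<in> S"
  obtains D where "D \<noteq> 0" and "\<And>z. z \<in> S \<Longrightarrow> \<exists>t. z = c + t *\<^sub>R D"
proof -
  have "collinear S"
    using assms by (simp add: collinear_aff_dim)
  then obtain D where D: "\<And>x y. x \<in> S \<Longrightarrow> y \<in> S \<Longrightarrow> \<exists>t. x - y = t *\<^sub>R D"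
    unfolding collinear_def by blast
  have line: "\<exists>t. z = c + t *\<^sub>R D" if "z \<in> S" for z
    using D[OF that assms(2)] by (metis add.commute diff_add_cancel)
  have "D \<noteq> 0"
  proof
    assume "D = 0"
    with line have "z = c" if "z \<in> S" for z using that by fastforce
    with assms(2) have "S = {c}" by blast
    with assms(1) show False by simp
  qed
  with line show thesis by (rule that[rotated])
qed

text \<open>If the curve is collinear with direction \<open>D\<close>, then \<open>A\<close> and \<open>B\<close> are multiples \<open>\<alpha> D\<close> and \<open>\<beta> D\<close>, and the
  curve is the image under \<open>t \<mapsto> C + t D\<close> of the range of \<open>\<alpha> x\<^sup>2 + 2 \<beta> x\<close>. For \<open>\<alpha> \<noteq> 0\<close> completing the
  square gives a half-line; for \<open>\<alpha> = 0\<close> the range is the whole line, as \<open>\<beta> = 0\<close> would give a point.\<close>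

lemma conic_parabola_half_line_or_line:
  fixes A B C :: "'a::euclidean_space"
  assumes "aff_dim (conic_parabola A B C) = 1"
  shows "is_half_line (conic_parabola A B C) \<or> is_line (conic_parabola A B C)"
proof -
  let ?P = "conic_parabola A B C"
  have mem: "x\<^sup>2 *\<^sub>R A + (2 * x) *\<^sub>R B + C \<in> ?P" for x
    by (auto simp: conic_parabola_def)
  have "C \<in> ?P" using mem[of 0] by simp
  then obtain D where D: "D \<noteq> 0" "\<And>z. z \<in> ?P \<Longrightarrow> \<exists>t. z = C + t *\<^sub>R D"
    using aff_dim_1_line[OF assms] by blast
  obtain s t where s: "A + 2 *\<^sub>R B = s *\<^sub>R D" and t: "A - 2 *\<^sub>R B = t *\<^sub>R D"
    using D(2)[OF mem[of 1]] D(2)[OF mem[of "-1"]] by (auto simp: algebra_simps)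
  define \<alpha> \<beta> where "\<alpha> = (s + t) / 2" and "\<beta> = (s - t) / 4"
  have "A = (1/2) *\<^sub>R ((A + 2 *\<^sub>R B) + (A - 2 *\<^sub>R B))" by (simp flip: scaleR_2)
  then have A: "A = \<alpha> *\<^sub>R D" unfolding s t \<alpha>_def by (simp add: algebra_simps add_divide_distrib)
  have "B = (1/4) *\<^sub>R ((A + 2 *\<^sub>R B) - (A - 2 *\<^sub>R B))" by (simp flip: scaleR_add_left)
  then have B: "B = \<beta> *\<^sub>R D" unfolding s t \<beta>_def by (simp add: algebra_simps diff_divide_distrib)
  have P: "?P = {C + (\<alpha> * x\<^sup>2 + 2 * \<beta> * x) *\<^sub>R D | x. True}"
    unfolding conic_parabola_def A B by (simp add: algebra_simps)
  show ?thesis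
  proof (cases "\<alpha> = 0")
    case False
    have "?P = {(C - (\<beta>\<^sup>2 / \<alpha>) *\<^sub>R D) + r *\<^sub>R (\<alpha> *\<^sub>R D) | r. r \<ge> 0}"
    proof (intro equalityI subsetI)
      fix z assume "z \<in> ?P"
      then obtain x where z: "z = C + (\<alpha> * x\<^sup>2 + 2 * \<beta> * x) *\<^sub>R D" unfolding P by blast
      have "\<alpha> * x\<^sup>2 + 2 * \<beta> * x = - (\<beta>\<^sup>2 / \<alpha>) + (x + \<beta> / \<alpha>)\<^sup>2 * \<alpha>"
        using False by (simp add: power2_eq_square field_simps)
      then have "z = (C - (\<beta>\<^sup>2 / \<alpha>) *\<^sub>R D) + (x + \<beta> / \<alpha>)\<^sup>2 *\<^sub>R (\<alpha> *\<^sub>R D)"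
        unfolding z by (simp only: scaleR_add_left scaleR_minus_left) simp
      then show "z \<in> {(C - (\<beta>\<^sup>2 / \<alpha>) *\<^sub>R D) + r *\<^sub>R (\<alpha> *\<^sub>R D) | r. r \<ge> 0}"
        using zero_le_power2 by blast
    next
      fix z assume "z \<in> {(C - (\<beta>\<^sup>2 / \<alpha>) *\<^sub>R D) + r *\<^sub>R (\<alpha> *\<^sub>R D) | r. r \<ge> 0}"
      then obtain r where z: "z = (C - (\<beta>\<^sup>2 / \<alpha>) *\<^sub>R D) + r *\<^sub>R (\<alpha> *\<^sub>R D)" and "r \<ge> 0" by blast
      define x where "x = sqrt r - \<beta> / \<alpha>"
      have "r = (x + \<beta> / \<alpha>)\<^sup>2" using \<open>r \<ge> 0\<close> by (simp add: x_def)
      then have "\<alpha> * x\<^sup>2 + 2 * \<beta> * x = - (\<beta>\<^sup>2 / \<alpha>) + r * \<alpha>"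
        using False by (simp add: power2_eq_square field_simps)
      then have "z = C + (\<alpha> * x\<^sup>2 + 2 * \<beta> * x) *\<^sub>R D"
        unfolding z by (simp only: scaleR_add_left scaleR_minus_left) simp
      then show "z \<in> ?P" unfolding P by blast
    qed
    then show ?thesis
      using False D(1) unfolding is_half_line_def by (intro disjI1 exI[of _ "C - (\<beta>\<^sup>2 / \<alpha>) *\<^sub>R D"] exI[of _ "\<alpha> *\<^sub>R D"]) simp
  next
    case True
    have "\<beta> \<noteq> 0"
    proof
      assume "\<beta> = 0"
      with True have "?P = {C}" unfolding P by simp
      with assms show False by simp
    qed
    have "?P = {C + r *\<^sub>R D | r. True}"
    proof (intro equalityI subsetI)
      fix z assume "z \<in> {C + r *\<^sub>R D | r. True}"
      then obtain r where "z = C + r *\<^sub>R D" by blast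
      then have "z = C + (\<alpha> * (r / (2 * \<beta>))\<^sup>2 + 2 * \<beta> * (r / (2 * \<beta>))) *\<^sub>R D"
        using True \<open>\<beta> \<noteq> 0\<close> by simp
      then show "z \<in> ?P" unfolding P by blast
    qed (auto simp: P)
    then show ?thesis
      using D(1) unfolding is_line_def by blast
  qed
qed

lemma aff_dim_line_le: 
  fixes S :: "'a::euclidean_space set"
  assumes "is_line S" shows "aff_dim S \<le> 1"
proof -
  obtain x d where S: "S = {x + t *\<^sub>R d | t. True}"
    using assms unfolding is_line_def by blast
  have "collinear S"
    unfolding collinear_def
  proof (intro exI[of _ d] ballI)
    fix y z assume "y \<in> S" "z \<in> S"
    then obtain s t where "y = x + s *\<^sub>R d" "z = x + t *\<^sub>R d" unfolding S by blast
    then have "y - z = (s - t) *\<^sub>R d" by (simp add: algebra_simps)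
    then show "\<exists>c. y - z = c *\<^sub>R d" ..
  qed
  then show ?thesis by (simp add: collinear_aff_dim)
qed

lemma aff_dim_degenerate_ellipse_le:
  fixes S :: "'a::euclidean_space set"
  assumes "degenerate_ellipse S"
  shows "aff_dim S \<le> 1"
  using assms unfolding degenerate_ellipse_def is_segment_def is_point_def
  by (metis collinear_aff_dim collinear_closed_segment collinear_sing)

lemma aff_dim_degenerate_parabola_le:
  fixes S :: "'a::euclidean_space set"
  assumes "degenerate_parabola S"
  shows "aff_dim S \<le> 1"
proof -
  have "aff_dim S \<le> 1" if half: "is_half_line S"
  proof -
    obtain x d where "d \<noteq> 0" and S: "S = {x + t *\<^sub>R d | t. t \<ge> 0}"
      using half unfolding is_half_line_def by blast
    then have "is_line {x + t *\<^sub>R d | t. True}" unfolding is_line_def by blast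
    then have "aff_dim {x + t *\<^sub>R d | t. True} \<le> 1" by (rule aff_dim_line_le)
    moreover have "aff_dim S \<le> aff_dim {x + t *\<^sub>R d | t. True}"
      unfolding S by (intro aff_dim_subset) blast
    ultimately show ?thesis by simp
  qed
  then show ?thesis
    using assms aff_dim_line_le[of S] unfolding degenerate_parabola_def is_point_def
    by auto
qed

text \<open>A line through the origin that contains \<open>S\<close> would contain \<open>insert 0 S\<close>, of affine dimension 2.\<close>

lemma umbilic_curvature_not_0_imp_not_radial:
  fixes S :: "'a::euclidean_space set"
  assumes "aff_dim S = 1" and "umbilic_curvature S \<noteq> 0"
  shows "\<not> radial S"
proof
  assume "radial S"
  then obtain l where l: "is_line l" "insert 0 S \<subseteq> l" unfolding radial_def by auto
  then have "aff_dim (insert 0 S) \<le> 1"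
    using aff_dim_subset[OF l(2)] aff_dim_line_le[OF l(1)] by simp
  moreover have "S \<noteq> {}" using assms(1) by auto
  then have "0 \<notin> affine hull S" using assms(2) umbilic_curvature_eq_0_iff by blast
  ultimately show False using assms(1) by (simp add: aff_dim_insert)
qed

text \<open>Inside a plane the affine dimension accounts for at most 2 of the 3 linear dimensions; the third
  must come from an origin off the affine hull.\<close>

lemma umbilic_curvature_nonzero_if_dim_3:
  fixes S :: "'a::euclidean_space set"
  assumes "dim S = 3" and "aff_dim S \<le> 2"
  shows "umbilic_curvature S \<noteq> 0"
proof -
  have "S \<noteq> {}" using assms(1) by auto
  from dim_eq_aff_dim_umbilic_curvature[OF this] assms show ?thesis by auto
qed

lemma aff_dim_if_dim_2:
  fixes S :: "'a::euclidean_space set"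
  assumes "dim S = 2"
  shows "aff_dim S = (if umbilic_curvature S = 0 then 2 else 1)"
proof -
  have "S \<noteq> {}" using assms by auto
  from dim_eq_aff_dim_umbilic_curvature[OF this] assms show ?thesis by auto
qed

lemma not_is_point_if_dim_2:
  fixes S :: "'a::euclidean_space set"
  assumes "dim S = 2"
  shows "\<not> is_point S"
  using aff_dim_if_dim_2[OF assms] by (auto simp: is_point_def split: if_splits)

text \<open>In dimension 2, \<open>\<kappa> \<noteq> 0\<close> forces affine dimension 1 and keeps the origin off the affine hull,
  hence off the curve (for the parabola: off the line that carries it); conversely a degenerate
  curve has affine dimension at most 1, which excludes \<open>\<kappa> = 0\<close>.\<close>

lemma conic_ellipse_dim_2:
  fixes A B C :: "'a::euclidean_space"
  assumes "dim (conic_ellipse A B C) = 2"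
  defines "E \<equiv> conic_ellipse A B C"
  shows "degenerate_ellipse E \<longleftrightarrow> umbilic_curvature E \<noteq> 0"
    and "is_segment E \<and> 0 \<notin> E \<longleftrightarrow> umbilic_curvature E \<noteq> 0"
proof -
  have ne: "E \<noteq> {}" unfolding E_def by (rule conic_ellipse_nonempty)
  have eq: "aff_dim E = (if umbilic_curvature E = 0 then 2 else 1)"
    unfolding E_def by (rule aff_dim_if_dim_2[OF assms(1)])
  have seg: "is_segment E" if "umbilic_curvature E \<noteq> 0"
    using that eq conic_ellipse_segment[of A B C] unfolding E_def by simp
  have deg: "umbilic_curvature E \<noteq> 0" if "degenerate_ellipse E"
    using aff_dim_degenerate_ellipse_le[OF that] eq by (auto split: if_splits)
  show "degenerate_ellipse E \<longleftrightarrow> umbilic_curvature E \<noteq> 0"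
    using seg deg unfolding degenerate_ellipse_def by blast
  show "is_segment E \<and> 0 \<notin> E \<longleftrightarrow> umbilic_curvature E \<noteq> 0"
    using seg deg umbilic_curvature_eq_0_iff[OF ne] hull_inc[of 0 E affine]
    unfolding degenerate_ellipse_def by blast
qed

lemma conic_parabola_dim_2:
  fixes A B C :: "'a::euclidean_space"
  assumes "dim (conic_parabola A B C) = 2"
  defines "P \<equiv> conic_parabola A B C"
  shows "degenerate_parabola P \<longleftrightarrow> umbilic_curvature P \<noteq> 0"
    and "(is_half_line P \<or> is_line P) \<and> \<not> radial P \<longleftrightarrow> umbilic_curvature P \<noteq> 0"
proof -
  have eq: "aff_dim P = (if umbilic_curvature P = 0 then 2 else 1)"
    unfolding P_def by (rule aff_dim_if_dim_2[OF assms(1)])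
  have line: "is_half_line P \<or> is_line P" if "umbilic_curvature P \<noteq> 0"
    using that eq conic_parabola_half_line_or_line[of A B C] unfolding P_def by simp
  have deg: "umbilic_curvature P \<noteq> 0" if "degenerate_parabola P"
    using aff_dim_degenerate_parabola_le[OF that] eq by (auto split: if_splits)
  show "degenerate_parabola P \<longleftrightarrow> umbilic_curvature P \<noteq> 0"
    using line deg unfolding degenerate_parabola_def by blast
  show "(is_half_line P \<or> is_line P) \<and> \<not> radial P \<longleftrightarrow> umbilic_curvature P \<noteq> 0"
    using line deg eq umbilic_curvature_not_0_imp_not_radial[of P]
    unfolding degenerate_parabola_def by auto
qed

section \<open>Orthogonal projection onto a subspace\<close>

lemma orth_proj_eqI:
  assumes "subspace N" "y \<in> N" "x - y \<in> orthogonal_comp N"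
  shows "orth_proj N x = y"
  unfolding orth_proj_def
proof (rule the_equality)
  fix z assume z: "z \<in> N \<and> x - z \<in> orthogonal_comp N"
  have "z - y \<in> N" using assms z by (simp add: subspace_diff)
  moreover have "z - y \<in> orthogonal_comp N"
    using subspace_diff[OF subspace_orthogonal_comp assms(3), of "x - z"] z by simp
  ultimately have "orthogonal (z - y) (z - y)" unfolding orthogonal_comp_def by blast
  then show "z = y" by (simp add: orthogonal_self)
qed (use assms in simp)

lemma orth_proj_in:
  assumes "subspace N"
  shows "orth_proj N x \<in> N" and "x - orth_proj N x \<in> orthogonal_comp N"
proof -
  have "x \<in> N + orthogonal_comp N" using subspace_sum_orthogonal_comp[OF assms] by simp
  then obtain y z where "y \<in> N" "z \<in> orthogonal_comp N" "x = y + z" by (rule set_plus_elim)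
  then have "orth_proj N x = y" "y \<in> N" "x - y \<in> orthogonal_comp N"
    using orth_proj_eqI[OF assms, of y x] by auto
  then show "orth_proj N x \<in> N" "x - orth_proj N x \<in> orthogonal_comp N" by simp_all
qed

lemma linear_orth_proj:
  assumes "subspace N"
  shows "linear (orth_proj N)"
proof (rule linearI)
  fix x y and r :: real
  show "orth_proj N (x + y) = orth_proj N x + orth_proj N y"
    using subspace_add[OF subspace_orthogonal_comp orth_proj_in(2)[OF assms, of x] orth_proj_in(2)[OF assms, of y]]
    by (intro orth_proj_eqI[OF assms]) (simp_all add: orth_proj_in assms subspace_add algebra_simps)
  show "orth_proj N (r *\<^sub>R x) = r *\<^sub>R orth_proj N x"
    using subspace_scale[OF subspace_orthogonal_comp orth_proj_in(2)[OF assms, of x], of r]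
    by (intro orth_proj_eqI[OF assms]) (simp_all add: orth_proj_in assms subspace_scale algebra_simps)
qed

section \<open>The curvature ellipse of a regular surface\<close>

text \<open>What the second fundamental form at one point needs of a local parametrization.\<close>

locale surface_patch =
  fixes U :: "(real^2) set" and \<phi> :: "real^2 \<Rightarrow> 'a::euclidean_space" and a :: "real^2"
  assumes open_domain: "open U"
    and smooth: "smooth_on U \<phi>"
    and base_point: "a \<in> U"
    and immersion: "inj (frechet_derivative \<phi> (at a))"
begin

lemma linear_tangent_map: "linear (frechet_derivative \<phi> (at a))"
  using C2_on(1)[OF smooth base_point] by (rule linear_frechet_derivative)

lemma subspace_tangent_space: "subspace (tangent_space \<phi> a)"
  unfolding tangent_space_def using linear_tangent_map by (simp add: linear_subspace_image)

lemma subspace_normal_space: "subspace (normal_space_reg \<phi> a)"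
  unfolding normal_space_reg_def by (rule subspace_orthogonal_comp)

lemma orthogonal_comp_normal_space: "orthogonal_comp (normal_space_reg \<phi> a) = tangent_space \<phi> a"
  unfolding normal_space_reg_def by (rule orthogonal_comp_self[OF subspace_tangent_space])

lemma tangent_map_tangent_coords:
  "v \<in> tangent_space \<phi> a \<Longrightarrow> frechet_derivative \<phi> (at a) (tangent_coords \<phi> a v) = v"
  unfolding tangent_space_def tangent_coords_def by (rule f_inv_into_f)

lemma tangent_coords_combination:
  assumes "v \<in> tangent_space \<phi> a" "w \<in> tangent_space \<phi> a"
  shows "tangent_coords \<phi> a (x *\<^sub>R v + y *\<^sub>R w) = x *\<^sub>R tangent_coords \<phi> a v + y *\<^sub>R tangent_coords \<phi> a w"
proof -
  have "frechet_derivative \<phi> (at a) (x *\<^sub>R tangent_coords \<phi> a v + y *\<^sub>R tangent_coords \<phi> a w) = x *\<^sub>R v + y *\<^sub>R w"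
    using assms by (simp add: linear_add[OF linear_tangent_map] linear_scale[OF linear_tangent_map]
        tangent_map_tangent_coords)
  then show ?thesis
    unfolding tangent_coords_def using immersion by (metis inv_f_f)
qed

lemma II_reg_quadratic:
  assumes "v \<in> tangent_space \<phi> a" "w \<in> tangent_space \<phi> a"
  shows "II_reg \<phi> a (x *\<^sub>R v + y *\<^sub>R w) (x *\<^sub>R v + y *\<^sub>R w) =
    x\<^sup>2 *\<^sub>R II_reg \<phi> a v v + (2 * x * y) *\<^sub>R II_reg \<phi> a v w + y\<^sup>2 *\<^sub>R II_reg \<phi> a w w"
  using linear_orth_proj[OF subspace_normal_space]
  by (simp add: II_reg_def tangent_coords_combination assms linear_add linear_scale
      second_derivative_quadratic[OF open_domain smooth base_point])

lemma II_reg_in_normal_space: "II_reg \<phi> a v w \<in> normal_space_reg \<phi> a"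
  unfolding II_reg_def by (rule orth_proj_in(1)[OF subspace_normal_space])

end

lemma orthonormal_basis_pairD:
  assumes "orthonormal_basis V [e1, e2]"
  shows "e1 \<in> V" "e2 \<in> V" "norm e1 = 1" "norm e2 = 1" "e1 \<bullet> e2 = 0"
    and "w \<in> V \<Longrightarrow> \<exists>x y. w = x *\<^sub>R e1 + y *\<^sub>R e2"
proof -
  have V: "V = span {e1, e2}" using assms by (simp add: orthonormal_basis_def)
  show "e1 \<in> V" "e2 \<in> V" unfolding V by (simp_all add: span_base)
  show "norm e1 = 1" "norm e2 = 1" using assms by (simp_all add: orthonormal_basis_def)
  show "e1 \<bullet> e2 = 0"
    using assms by (auto simp: orthonormal_basis_def pairwise_def orthogonal_def)
  show "w \<in> V \<Longrightarrow> \<exists>x y. w = x *\<^sub>R e1 + y *\<^sub>R e2"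
    unfolding V by (auto simp: span_insert algebra_simps)
qed

lemma norm_orthonormal_combination:
  assumes "norm e1 = 1" "norm e2 = 1" "e1 \<bullet> e2 = 0"
  shows "(norm (x *\<^sub>R e1 + y *\<^sub>R e2))\<^sup>2 = x\<^sup>2 + y\<^sup>2"
proof -
  have "e1 \<bullet> e1 = 1" "e2 \<bullet> e2 = 1" using assms by (simp_all add: norm_eq_1)
  then show ?thesis
    using assms(3) unfolding power2_norm_eq_inner
    by (simp add: inner_simps inner_commute[of e2 e1] power2_eq_square)
qed

text \<open>Rotating the given basis: if \<open>u = x e\<^sub>1 + y e\<^sub>2\<close>, then \<open>v = - y e\<^sub>1 + x e\<^sub>2\<close> completes it.\<close>

lemma orthonormal_basis_extend_unit_vector:
  assumes "orthonormal_basis V [e1, e2]" "u \<in> V" "norm u = 1"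
  obtains v where "orthonormal_basis V [u, v]"
proof -
  note e = orthonormal_basis_pairD[OF assms(1)]
  obtain x y where u: "u = x *\<^sub>R e1 + y *\<^sub>R e2" using e(6)[OF assms(2)] by blast
  have xy: "x\<^sup>2 + y\<^sup>2 = 1"
    using norm_orthonormal_combination[OF e(3-5), of x y] assms(3) u by simp
  define v where "v = (- y) *\<^sub>R e1 + x *\<^sub>R e2"
  have ee: "e1 \<bullet> e1 = 1" "e2 \<bullet> e2 = 1" using e by (simp_all add: norm_eq_1)
  have "(norm v)\<^sup>2 = 1"
    unfolding v_def norm_orthonormal_combination[OF e(3-5)] using xy by simp
  then have v: "norm v = 1"
    using norm_ge_zero[of v] by (auto simp: power2_eq_1_iff)
  have uv: "u \<bullet> v = 0"
    unfolding u v_def using ee e(5) by (simp add: inner_simps inner_commute[of e2 e1])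
  have e1: "e1 = x *\<^sub>R u - y *\<^sub>R v"
  proof -
    have "x *\<^sub>R u - y *\<^sub>R v = (x\<^sup>2 + y\<^sup>2) *\<^sub>R e1" unfolding u v_def by (simp add: algebra_simps power2_eq_square)
    then show ?thesis using xy by simp
  qed
  have e2: "e2 = y *\<^sub>R u + x *\<^sub>R v"
  proof -
    have "y *\<^sub>R u + x *\<^sub>R v = (x\<^sup>2 + y\<^sup>2) *\<^sub>R e2" unfolding u v_def by (simp add: algebra_simps power2_eq_square)
    then show ?thesis using xy by simp
  qed
  have "span {u, v} = span {e1, e2}"
    unfolding span_eq
  proof
    show "{u, v} \<subseteq> span {e1, e2}"
      unfolding u v_def by (auto intro!: span_add span_scale span_diff intro: span_base)
    have "e1 \<in> span {u, v}" unfolding e1 by (intro span_diff span_scale span_base) auto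
    moreover have "e2 \<in> span {u, v}" unfolding e2 by (intro span_add span_scale span_base) auto
    ultimately show "{e1, e2} \<subseteq> span {u, v}" by simp
  qed
  moreover have "u \<noteq> v" using uv v by (metis inner_eq_zero_iff norm_zero zero_neq_one)
  ultimately have "orthonormal_basis V [u, v]"
    using assms v uv
    by (auto simp: orthonormal_basis_def pairwise_def orthogonal_def inner_commute)
  then show thesis by (rule that)
qed

lemma (in surface_patch) curvature_ellipse_eq_conic:
  assumes "orthonormal_basis (tangent_space \<phi> a) [e1, e2]"
  shows "curvature_ellipse \<phi> a =
    conic_ellipse (II_reg \<phi> a e1 e1) (II_reg \<phi> a e1 e2) (II_reg \<phi> a e2 e2)"
proof -
  note e = orthonormal_basis_pairD[OF assms]
  have norm: "norm (x *\<^sub>R e1 + y *\<^sub>R e2) = 1 \<longleftrightarrow> x\<^sup>2 + y\<^sup>2 = 1" for x y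
    using norm_orthonormal_combination[OF e(3-5), of x y] by (metis norm_ge_zero one_power2 power2_eq_iff_nonneg zero_le_one)
  have mem: "x *\<^sub>R e1 + y *\<^sub>R e2 \<in> tangent_space \<phi> a" for x y
    using e(1,2) subspace_tangent_space by (simp add: subspace_add subspace_scale)
  show ?thesis
  proof (intro equalityI subsetI)
    fix z assume "z \<in> curvature_ellipse \<phi> a"
    then obtain w where w: "z = II_reg \<phi> a w w" "w \<in> tangent_space \<phi> a" "norm w = 1"
      by (auto simp: curvature_ellipse_def)
    obtain x y where "w = x *\<^sub>R e1 + y *\<^sub>R e2" using e(6)[OF w(2)] by blast
    then show "z \<in> conic_ellipse (II_reg \<phi> a e1 e1) (II_reg \<phi> a e1 e2) (II_reg \<phi> a e2 e2)"
      using w norm II_reg_quadratic[OF e(1,2)] unfolding conic_ellipse_def by auto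
  next
    fix z assume "z \<in> conic_ellipse (II_reg \<phi> a e1 e1) (II_reg \<phi> a e1 e2) (II_reg \<phi> a e2 e2)"
    then obtain x y where "z = II_reg \<phi> a (x *\<^sub>R e1 + y *\<^sub>R e2) (x *\<^sub>R e1 + y *\<^sub>R e2)" "x\<^sup>2 + y\<^sup>2 = 1"
      by (auto simp: conic_ellipse_def II_reg_quadratic[OF e(1,2)])
    then show "z \<in> curvature_ellipse \<phi> a"
      using norm mem unfolding curvature_ellipse_def by blast
  qed
qed

text \<open>Coordinates in an orthonormal frame of the normal space are injective there, so the rank of
  \<open>alpha_matrix\<close> is the dimension of the span of its columns as normal vectors.\<close>

lemma dim_image_orthonormal_coordinates:
  fixes n1 n2 n3 :: "real^5"
  assumes "orthonormal_basis N [n1, n2, n3]" "S \<subseteq> N"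
  shows "dim ((\<lambda>x. vector [x \<bullet> n1, x \<bullet> n2, x \<bullet> n3] :: real^3) ` S) = dim S"
proof (rule dim_image_eq)
  let ?c = "\<lambda>x. vector [x \<bullet> n1, x \<bullet> n2, x \<bullet> n3] :: real^3"
  show lin: "linear ?c"
    by (rule linearI) (simp_all add: vec_eq_iff forall_3 inner_simps)
  have N: "N = span {n1, n2, n3}" using assms(1) by (simp add: orthonormal_basis_def)
  have "x = 0" if x: "x \<in> N" "?c x = 0" for x
  proof -
    have "x \<bullet> n1 = 0" "x \<bullet> n2 = 0" "x \<bullet> n3 = 0"
      using x(2) by (simp_all add: vec_eq_iff forall_3)
    then have ortho: "\<And>n. n \<in> {n1, n2, n3} \<Longrightarrow> orthogonal x n"
      by (auto simp: orthogonal_def)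
    have "orthogonal x x"
      using x(1) ortho unfolding N by (rule orthogonal_to_span)
    then show "x = 0" by (simp add: orthogonal_self)
  qed
  moreover have "subspace N" unfolding N by (rule subspace_span)
  ultimately have "inj_on ?c N"
    using lin by (simp add: linear_inj_on_iff_eq_0)
  moreover have "span S \<subseteq> N" using assms(2) unfolding N by (rule span_minimal) simp
  ultimately show "inj_on ?c (span S)" by (rule inj_on_subset)
qed

text \<open>The ellipse does not refer to a basis, so this also shows that the rank does not depend on the
  choice of orthonormal bases.\<close>

lemma in_stratum_imp_dim_curvature_ellipse:
  assumes "surface_patch U \<phi> a" "in_stratum \<phi> a i"
  obtains e1 e2 where "orthonormal_basis (tangent_space \<phi> a) [e1, e2]"
    and "dim (curvature_ellipse \<phi> a) = i"
proof -
  interpret surface_patch U \<phi> a by fact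
  obtain e1 e2 n1 n2 n3 where e: "orthonormal_basis (tangent_space \<phi> a) [e1, e2]"
    and n: "orthonormal_basis (normal_space_reg \<phi> a) [n1, n2, n3]"
    and rank: "rank (alpha_matrix \<phi> a e1 e2 n1 n2 n3) = i"
    using assms(2) unfolding in_stratum_def by blast
  let ?c = "\<lambda>x. vector [x \<bullet> n1, x \<bullet> n2, x \<bullet> n3] :: real^3"
  let ?S = "{II_reg \<phi> a e1 e1, II_reg \<phi> a e1 e2, II_reg \<phi> a e2 e2}"
  have rows: "rows (vector [r, s, t] :: real^3^3) = {r, s, t}" for r s t
  proof -
    have "rows M = ($) M ` {1, 2, 3}" for M :: "real^3^3"
      unfolding rows_def row_def by (auto simp: image_def simp flip: UNIV_3)
    then show ?thesis by simp
  qed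
  have "i = dim (?c ` ?S)"
    using rank unfolding alpha_matrix_def Let_def rank_transpose
    unfolding row_rank_def rows by simp
  also have "\<dots> = dim ?S"
    by (rule dim_image_orthonormal_coordinates[OF n]) (simp add: II_reg_in_normal_space)
  also have "\<dots> = dim (curvature_ellipse \<phi> a)"
    unfolding curvature_ellipse_eq_conic[OF e] by (metis dim_span span_conic_ellipse)
  finally show thesis using that[OF e] by simp
qed

section \<open>The curvature parabola of a projection along a tangent vector\<close>

locale projected_patch = surface_patch U \<phi> a
  for U :: "(real^2) set" and \<phi> :: "real^2 \<Rightarrow> real^5" and a :: "real^2" +
  fixes u :: "real^5" and J :: "real^5 \<Rightarrow> real^4"
  assumes tangent: "u \<in> tangent_space \<phi> a"
    and unit: "norm u = 1"
    and identification: "identifies_complement u J"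
begin

lemma linear_J: "linear J"
  using identification by (simp add: identifies_complement_def)

text \<open>Polarization of the isometry property.\<close>

lemma inner_J:
  assumes "x \<bullet> u = 0" "y \<bullet> u = 0"
  shows "J x \<bullet> J y = x \<bullet> y"
proof -
  have norm: "norm (J z) = norm z" if "z \<bullet> u = 0" for z
    using identification that
    by (simp add: identifies_complement_def orthogonal_comp_def orthogonal_def inner_commute)
  have "norm (J x + J y) = norm (x + y)"
    using norm[of "x + y"] assms by (simp add: linear_add[OF linear_J] inner_simps)
  then show ?thesis
    using norm assms by (simp add: dot_norm)
qed

lemma proj_along_orthogonal: "proj_along u x \<bullet> u = 0"
  using unit by (simp add: proj_along_def inner_simps norm_eq_1)

lemma linear_proj_along: "linear (proj_along u)"
  by (rule linearI) (simp_all add: proj_along_def inner_simps algebra_simps)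

lemma linear_projection: "linear (J \<circ> proj_along u)"
  using linear_proj_along linear_J by (rule linear_compose)

lemma proj_along_id: "x \<bullet> u = 0 \<Longrightarrow> proj_along u x = x"
  by (simp add: proj_along_def)

lemma normal_orthogonal:
  assumes "n \<in> normal_space_reg \<phi> a" "t \<in> tangent_space \<phi> a"
  shows "n \<bullet> t = 0"
  using assms by (simp add: normal_space_reg_def orthogonal_comp_def orthogonal_def inner_commute[of n])

lemma differential_projection:
  assumes "w \<in> tangent_space \<phi> a"
  shows "differential (J \<circ> proj_along u) \<phi> a w = J (proj_along u w)"
  using frechet_derivative_bounded_linear_compose[of "J \<circ> proj_along u" \<phi> a]
    linear_projection C2_on(1)[OF smooth base_point] tangent_map_tangent_coords[OF assms]
  by (simp add: differential_def linear_conv_bounded_linear)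

text \<open>Projecting along \<open>u\<close> commutes with taking normal parts: the tangential part of the second
  derivative stays tangential, and the normal part is orthogonal to \<open>u\<close>, so the projection does
  not move it and its image remains orthogonal to the image of the tangent plane.\<close>

lemma II_sing_eq_J_II_reg:
  "II_sing (J \<circ> proj_along u) \<phi> a v w = J (II_reg \<phi> a v w)"
proof -
  let ?g = "J \<circ> proj_along u"
  let ?z = "second_derivative \<phi> a (tangent_coords \<phi> a v) (tangent_coords \<phi> a w)"
  let ?n = "II_reg \<phi> a v w"
  have n: "?n \<in> normal_space_reg \<phi> a" by (rule II_reg_in_normal_space)
  have N: "normal_space_sing ?g \<phi> a = orthogonal_comp (?g ` tangent_space \<phi> a)"
    unfolding normal_space_sing_def by (simp add: differential_projection cong: image_cong)
  have gn: "?g ?n = J ?n"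
    using normal_orthogonal[OF n tangent] by (simp add: proj_along_id)
  have "orth_proj (normal_space_sing ?g \<phi> a) (?g ?z) = J ?n"
  proof (rule orth_proj_eqI)
    show "subspace (normal_space_sing ?g \<phi> a)"
      unfolding N by (rule subspace_orthogonal_comp)
    have "J (proj_along u t) \<bullet> J ?n = 0" if t: "t \<in> tangent_space \<phi> a" for t
    proof -
      have "J (proj_along u t) \<bullet> J ?n = proj_along u t \<bullet> ?n"
        using proj_along_orthogonal normal_orthogonal[OF n tangent] by (rule inner_J)
      also have "\<dots> = 0"
        using normal_orthogonal[OF n tangent] normal_orthogonal[OF n t]
        by (simp add: proj_along_def inner_simps inner_commute)
      finally show ?thesis .
    qed
    then show "J ?n \<in> normal_space_sing ?g \<phi> a"
      unfolding N by (auto simp: orthogonal_comp_def orthogonal_def)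
    have "?z - ?n \<in> tangent_space \<phi> a"
      unfolding II_reg_def orthogonal_comp_normal_space[symmetric]
      by (rule orth_proj_in(2)[OF subspace_normal_space])
    moreover have "?g ?z - J ?n = ?g (?z - ?n)"
      unfolding gn[symmetric] by (rule linear_diff[OF linear_projection, symmetric])
    ultimately show "?g ?z - J ?n \<in> orthogonal_comp (normal_space_sing ?g \<phi> a)"
      unfolding N using orthogonal_comp_subset by fastforce
  qed
  then show ?thesis
    unfolding II_sing_def
    using second_derivative_bounded_linear_compose[OF _ open_domain smooth base_point, of ?g]
      linear_projection by (simp add: linear_conv_bounded_linear)
qed

text \<open>For \<open>w = x u + y v\<close> the differential only sees \<open>y v\<close>, so \<open>I(w, w) = 1\<close> means \<open>y = \<plusminus> 1\<close>. Both signs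
  give the same values, as \<open>II(w, w)\<close> is even in \<open>w\<close>.\<close>

lemma curvature_parabola_eq_conic:
  assumes "orthonormal_basis (tangent_space \<phi> a) [u, v]"
  shows "curvature_parabola (J \<circ> proj_along u) \<phi> a =
    conic_parabola (J (II_reg \<phi> a u u)) (J (II_reg \<phi> a u v)) (J (II_reg \<phi> a v v))"
proof -
  let ?g = "J \<circ> proj_along u"
  let ?P = "conic_parabola (J (II_reg \<phi> a u u)) (J (II_reg \<phi> a u v)) (J (II_reg \<phi> a v v))"
  note e = orthonormal_basis_pairD[OF assms]
  have mem: "x *\<^sub>R u + y *\<^sub>R v \<in> tangent_space \<phi> a" for x y
    using e(1,2) subspace_tangent_space by (simp add: subspace_add subspace_scale)
  have vv: "v \<bullet> v = 1" "u \<bullet> u = 1" using e by (simp_all add: norm_eq_1)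
  have I: "I_sing ?g \<phi> a (x *\<^sub>R u + y *\<^sub>R v) (x *\<^sub>R u + y *\<^sub>R v) = y\<^sup>2" for x y
  proof -
    have "proj_along u (x *\<^sub>R u + y *\<^sub>R v) = y *\<^sub>R v"
      using e(5) vv by (simp add: proj_along_def inner_simps inner_commute[of v u])
    then show ?thesis
      using e(5) vv inner_J[of "y *\<^sub>R v" "y *\<^sub>R v"]
      by (simp add: I_sing_def differential_projection[OF mem] inner_commute[of v u] power2_eq_square)
  qed
  have II: "II_sing ?g \<phi> a (x *\<^sub>R u + y *\<^sub>R v) (x *\<^sub>R u + y *\<^sub>R v) =
      x\<^sup>2 *\<^sub>R J (II_reg \<phi> a u u) + (2 * x * y) *\<^sub>R J (II_reg \<phi> a u v) + y\<^sup>2 *\<^sub>R J (II_reg \<phi> a v v)" for x y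
    by (simp add: II_sing_eq_J_II_reg II_reg_quadratic[OF e(1,2)]
        linear_add[OF linear_J] linear_scale[OF linear_J])
  show ?thesis
  proof (intro equalityI subsetI)
    fix z assume "z \<in> curvature_parabola ?g \<phi> a"
    then obtain w where w: "z = II_sing ?g \<phi> a w w" "w \<in> tangent_space \<phi> a" "I_sing ?g \<phi> a w w = 1"
      by (auto simp: curvature_parabola_def unit_tangents_sing_def)
    obtain x y where wxy: "w = x *\<^sub>R u + y *\<^sub>R v" using e(6)[OF w(2)] by blast
    have y: "y\<^sup>2 = 1" using w(3) I unfolding wxy by simp
    \<comment> \<open>the point with parameter \<open>x y = x / y\<close>, since \<open>y = \<plusminus> 1\<close>\<close>
    have "z = (x * y)\<^sup>2 *\<^sub>R J (II_reg \<phi> a u u) + (2 * (x * y)) *\<^sub>R J (II_reg \<phi> a u v) + J (II_reg \<phi> a v v)"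
      unfolding w(1) wxy II by (simp add: power_mult_distrib y mult.assoc)
    then show "z \<in> ?P" unfolding conic_parabola_def by blast
  next
    fix z assume "z \<in> ?P"
    then obtain x where "z = II_sing ?g \<phi> a (x *\<^sub>R u + 1 *\<^sub>R v) (x *\<^sub>R u + 1 *\<^sub>R v)"
      unfolding II by (auto simp: conic_parabola_def)
    moreover have "I_sing ?g \<phi> a (x *\<^sub>R u + 1 *\<^sub>R v) (x *\<^sub>R u + 1 *\<^sub>R v) = 1"
      unfolding I by simp
    ultimately show "z \<in> curvature_parabola ?g \<phi> a"
      using mem unfolding curvature_parabola_def unit_tangents_sing_def by blast
  qed
qed

lemma dim_J_normal:
  assumes "S \<subseteq> normal_space_reg \<phi> a"
  shows "dim (J ` S) = dim S"
proof (rule dim_image_eq[OF linear_J])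
  have "span S \<subseteq> normal_space_reg \<phi> a"
    using assms subspace_normal_space by (rule span_minimal)
  then have "x = 0" if "x \<in> span S" "J x = 0" for x
    using inner_J[of x x] that normal_orthogonal[OF _ tangent] by auto
  then show "inj_on J (span S)"
    using linear_J by (simp add: linear_inj_on_iff_eq_0)
qed

text \<open>The two curves are conics whose coefficient vectors span spaces of the same dimension: the
  ellipse has the same span in every orthonormal tangent basis, in particular in one that starts
  with \<open>u\<close>, and \<open>J\<close> carries the coefficients in that basis injectively to those of the parabola.\<close>

lemma in_stratum_imp_conics:
  assumes "in_stratum \<phi> a i"
  obtains A B C A' B' C' where "curvature_ellipse \<phi> a = conic_ellipse A B C"
    and "dim (conic_ellipse A B C) = i"
    and "curvature_parabola (J \<circ> proj_along u) \<phi> a = conic_parabola A' B' C'"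
    and "dim (conic_parabola A' B' C') = i"
proof -
  obtain e1 e2 where e: "orthonormal_basis (tangent_space \<phi> a) [e1, e2]"
    and dim: "dim (curvature_ellipse \<phi> a) = i"
    using in_stratum_imp_dim_curvature_ellipse[OF surface_patch_axioms assms] by blast
  obtain v where v: "orthonormal_basis (tangent_space \<phi> a) [u, v]"
    using orthonormal_basis_extend_unit_vector[OF e tangent unit] by blast
  let ?A = "II_reg \<phi> a u u" and ?B = "II_reg \<phi> a u v" and ?C = "II_reg \<phi> a v v"
  have "dim (conic_parabola (J ?A) (J ?B) (J ?C)) = dim (J ` {?A, ?B, ?C})"
    by (metis dim_span span_conic_parabola image_insert image_empty)
  also have "\<dots> = dim {?A, ?B, ?C}"
    by (rule dim_J_normal) (simp add: II_reg_in_normal_space)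
  also have "\<dots> = dim (conic_ellipse ?A ?B ?C)"
    by (metis dim_span span_conic_ellipse)
  finally show thesis
    using curvature_ellipse_eq_conic[OF v] curvature_parabola_eq_conic[OF v] dim
    by (intro that) simp_all
qed

end

section \<open>Umbilic curvature and degeneracy of the two curves\<close>

theorem proposition3p3:
  fixes M :: "(real^5) set" and p u :: "real^5"
    and U :: "(real^2) set" and \<phi> :: "real^2 \<Rightarrow> real^5" and a :: "real^2"
    and J :: "real^5 \<Rightarrow> real^4" and g :: "real^5 \<Rightarrow> real^4"
  assumes "regular_surface M" and "p \<in> M"
    and "local_parametrization M U \<phi>" and "a \<in> U" and "\<phi> a = p"
    and "u \<in> tangent_space \<phi> a" and "norm u = 1"
    and "identifies_complement u J" and "g = J \<circ> proj_along u"
  shows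
    "(in_stratum \<phi> a 3 \<longrightarrow> kappa_u_reg \<phi> a * kappa_u_sing g \<phi> a \<noteq> 0) \<and>
     (in_stratum \<phi> a 2 \<longrightarrow>
        ((kappa_u_reg \<phi> a = 0 \<and> kappa_u_sing g \<phi> a = 0) \<longleftrightarrow>
         (\<not> degenerate_ellipse (curvature_ellipse \<phi> a) \<and>
          \<not> degenerate_parabola (curvature_parabola g \<phi> a))) \<and>
        ((\<not> degenerate_ellipse (curvature_ellipse \<phi> a) \<and>
          \<not> degenerate_parabola (curvature_parabola g \<phi> a)) \<longleftrightarrow>
         (\<not> semiumbilic_reg \<phi> a \<and> \<not> semiumbilic_sing g \<phi> a)) \<and>
        (kappa_u_reg \<phi> a * kappa_u_sing g \<phi> a \<noteq> 0 \<longleftrightarrow>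
         (degenerate_ellipse (curvature_ellipse \<phi> a) \<and> \<not> is_point (curvature_ellipse \<phi> a) \<and>
          degenerate_parabola (curvature_parabola g \<phi> a) \<and>
          \<not> is_point (curvature_parabola g \<phi> a))) \<and>
        ((degenerate_ellipse (curvature_ellipse \<phi> a) \<and> \<not> is_point (curvature_ellipse \<phi> a) \<and>
          degenerate_parabola (curvature_parabola g \<phi> a) \<and>
          \<not> is_point (curvature_parabola g \<phi> a)) \<longleftrightarrow>
         (semiumbilic_reg \<phi> a \<and> semiumbilic_sing g \<phi> a)))"
proof -
  interpret projected_patch U \<phi> a u J
    using assms by unfold_locales (auto simp: local_parametrization_def)
  note g = \<open>g = J \<circ> proj_along u\<close>
  have rank_3: "kappa_u_reg \<phi> a * kappa_u_sing g \<phi> a \<noteq> 0" if stratum: "in_stratum \<phi> a 3"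
  proof -
    obtain A B C A' B' C' where "curvature_ellipse \<phi> a = conic_ellipse A B C"
      and "dim (conic_ellipse A B C) = 3"
      and "curvature_parabola g \<phi> a = conic_parabola A' B' C'"
      and "dim (conic_parabola A' B' C') = 3"
      unfolding g by (rule in_stratum_imp_conics[OF stratum])
    then show ?thesis
      using umbilic_curvature_nonzero_if_dim_3[OF _ aff_dim_conic_ellipse_le, of A B C]
        umbilic_curvature_nonzero_if_dim_3[OF _ aff_dim_conic_parabola_le, of A' B' C']
      by (simp add: kappa_u_reg_def kappa_u_sing_def)
  qed
  have rank_2:
    "(degenerate_ellipse (curvature_ellipse \<phi> a) \<longleftrightarrow> kappa_u_reg \<phi> a \<noteq> 0) \<and>
     (semiumbilic_reg \<phi> a \<longleftrightarrow> kappa_u_reg \<phi> a \<noteq> 0) \<and>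
     \<not> is_point (curvature_ellipse \<phi> a) \<and>
     (degenerate_parabola (curvature_parabola g \<phi> a) \<longleftrightarrow> kappa_u_sing g \<phi> a \<noteq> 0) \<and>
     (semiumbilic_sing g \<phi> a \<longleftrightarrow> kappa_u_sing g \<phi> a \<noteq> 0) \<and>
     \<not> is_point (curvature_parabola g \<phi> a)" if stratum: "in_stratum \<phi> a 2"
  proof -
    obtain A B C A' B' C' where E: "curvature_ellipse \<phi> a = conic_ellipse A B C"
      and dim_E: "dim (conic_ellipse A B C) = 2"
      and P: "curvature_parabola g \<phi> a = conic_parabola A' B' C'"
      and dim_P: "dim (conic_parabola A' B' C') = 2"
      unfolding g by (rule in_stratum_imp_conics[OF stratum])
    show ?thesis
      unfolding kappa_u_reg_def kappa_u_sing_def semiumbilic_reg_def semiumbilic_sing_def E P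
      using conic_ellipse_dim_2[OF dim_E] conic_parabola_dim_2[OF dim_P]
        not_is_point_if_dim_2[OF dim_E] not_is_point_if_dim_2[OF dim_P] by blast
  qed
  show ?thesis
    using rank_3 rank_2 by auto
qed

end
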